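(* For any odd positive integer $M$, $$ \frac{1}{1-wq^M}\prod_{\substack{i\ge 1,\ i\text{ odd}\\ i\ne M}}\frac{1}{1-q^i} =1+\frac{q+q^2+\cdots+q^{M-1}+wq^M}{1-wq^M}+\sum_{j=2}^\infty \frac{q^{\binom{j+1}{2}}}{(q^2;q)_{j-1}}\,\frac{[M]_q}{1-wq^M}. $$
   Context: Here $w$ is an indeterminate and the identity is one of formal power series in $q$ with coefficients polynomial in $w$. Notation: $(A;q)_k=\prod_{i=0}^{k-1}(1-Aq^i)$ and $[M]_q=\frac{1-q^M}{1-q}=1+q+\cdots+q^{M-1}$. For $M=1$ the sum $q+\cdots+q^{M-1}$ is empty. *)

theory Defs
  imports "HOL-Analysis.Analysis"
begin

text \<open>
  The ambient ring is \<open>R[w][[q]]\<close>, rendered as \<^typ>\<open>'a poly fps\<close> for an arbitrary commutative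
  ring \<open>R\<close>.  Infinite sums and products are the library's \<^const>\<open>suminf\<close> and \<^const>\<open>prodinf\<close>,
  taken in the \<open>q\<close>-adic metric that the library puts on \<^typ>\<open>'a fps\<close>.
\<close>

abbreviation q_var :: "'a::comm_ring_1 poly fps"
  where "q_var \<equiv> fps_X"

abbreviation w_var :: "'a::comm_ring_1 poly fps"
  where "w_var \<equiv> fps_const (monom 1 1)"

text \<open>
  The library's \<^const>\<open>inverse\<close> on formal power series needs inverses in the coefficient type,
  which \<^typ>\<open>'a poly\<close> does not provide.  A series with constant coefficient \<open>1\<close> is nevertheless
  invertible over any commutative ring; \<open>fps_recip\<close> is meaningful for such series only.
\<close>

definition fps_recip :: "'a::comm_ring_1 fps \<Rightarrow> 'a fps"
  where "fps_recip f = fps_right_inverse f 1"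

lemma fps_recip_right: "fps_nth f 0 = 1 \<Longrightarrow> f * fps_recip f = 1"
  for f :: "'a::comm_ring_1 fps"
  unfolding fps_recip_def by (rule fps_right_inverse) simp

lemma fps_recip_unique:
  fixes f g :: "'a::comm_ring_1 fps"
  assumes "fps_nth f 0 = 1" and "f * g = 1"
  shows "g = fps_recip f"
  by (metis assms fps_recip_right mult.assoc mult.commute mult_1)

definition q_poch :: "'a::comm_ring_1 \<Rightarrow> 'a \<Rightarrow> nat \<Rightarrow> 'a"
  where "q_poch A q k = (\<Prod>i<k. 1 - A * q ^ i)"

definition q_bracket :: "'a::comm_ring_1 \<Rightarrow> nat \<Rightarrow> 'a"
  where "q_bracket q M = (\<Sum>i<M. q ^ i)"

lemma q_bracket_quotient: "(1 - q) * q_bracket q M = 1 - q ^ M"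
  unfolding q_bracket_def by (rule one_diff_power_eq [symmetric])

text \<open>The factor of the product at index \<open>i\<close>; excluded indices contribute \<open>1\<close>.\<close>

definition odd_factor :: "nat \<Rightarrow> nat \<Rightarrow> 'a::comm_ring_1 poly fps"
  where "odd_factor M i = (if odd i \<and> i \<noteq> M then fps_recip (1 - q_var ^ i) else 1)"

definition sum_term :: "nat \<Rightarrow> nat \<Rightarrow> 'a::comm_ring_1 poly fps"
  where "sum_term M j =
    q_var ^ ((j + 1) choose 2) * fps_recip (q_poch (q_var ^ 2) q_var (j - 1))
      * (q_bracket q_var M * fps_recip (1 - w_var * q_var ^ M))"

end

theory Submission
  imports Defs
begin

text \<open>
  Up to elementary algebra, the identity is Euler's
  \[ \prod_{i\ \mathrm{odd}} \frac{1}{1-q^i} = \sum_{j \ge 0} \frac{q^{j(j+1)/2}}{(q;q)_j}. \]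
  Write \<open>E\<close> for this series and \<open>D = 1/(1 - w q^M)\<close>.  Removing the factor at \<open>M\<close> turns the left-hand
  side of the theorem into \<open>D (1 - q^M) E = D [M] (1 - q) E\<close>.  The terms of \<open>(1 - q) E\<close> with indices \<open>0\<close> and \<open>1\<close>
  are \<open>1 - q\<close> and \<open>q\<close>, which add up to \<open>1\<close>, and those from index \<open>2\<close> on are \<open>q^(j+1 choose 2) / (q^2;q)_(j-1)\<close>.  So the left-hand side
  is \<open>D [M]\<close> plus the infinite sum of the theorem, and \<open>D [M]\<close> equals
  \<open>1 + (q + \<dots> + q^(M-1) + w q^M) D\<close>.

  Both sides of Euler's identity are compared with \<open>\<Prod>(1 + q^i)\<close>, the generating function of
  partitions into distinct parts.  On the sum side, \<open>F k = \<Sum>j. q^(k j) q^(j+1 choose 2) / (q;q)_j\<close>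
  satisfies \<open>F k = (1 + q^(k+1)) F (k+1)\<close> (lemma \<open>distinct_series_step\<close>), and \<open>F n\<close> tends to
  \<open>1\<close>, so \<open>F 0\<close> is the product.  On the product side,
  \<open>(1 - q)(1 - q^3)\<cdots>(1 - q^(2n-1)) (1 + q)\<cdots>(1 + q^n) (q;q)_n = (q;q)_(2n)\<close>
  (lemma \<open>odd_times_distinct\<close>), and \<open>(q;q)_(2n)\<close> agrees with \<open>(q;q)_n\<close> modulo \<open>q^n\<close>.
  As \<open>'a\<close> is an arbitrary commutative ring, division is always multiplication by the reciprocal of
  a series with constant coefficient \<open>1\<close>, and all convergence is \<open>q\<close>-adic.
\<close>

section \<open>The \<open>q\<close>-adic topology\<close>

text \<open>
  Ring operations are \<open>q\<close>-adically continuous because each coefficient of a result depends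
  on finitely many coefficients of the arguments.
\<close>

instance fps :: (ab_group_add) topological_comm_monoid_add
proof
  fix a b :: "'a fps"
  show "((\<lambda>x. fst x + snd x) \<longlongrightarrow> a + b) (nhds a \<times>\<^sub>F nhds b)"
  proof (rule tendsto_fpsI)
    fix n
    show "\<forall>\<^sub>F x in nhds a \<times>\<^sub>F nhds b. fps_nth (fst x + snd x) n = fps_nth (a + b) n"
      unfolding eventually_prod_filter
      by (rule exI[of _ "\<lambda>f. fps_nth f n = fps_nth a n"],
          rule exI[of _ "\<lambda>f. fps_nth f n = fps_nth b n"])
         (simp add: eventually_fps_nth_eq_nhds_fps)
  qed
qed

instance fps :: (comm_ring_1) topological_semigroup_mult
proof
  fix a b :: "'a fps"
  show "((\<lambda>x. fst x * snd x) \<longlongrightarrow> a * b) (nhds a \<times>\<^sub>F nhds b)"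
  proof (rule tendsto_fpsI)
    fix n
    show "\<forall>\<^sub>F x in nhds a \<times>\<^sub>F nhds b. fps_nth (fst x * snd x) n = fps_nth (a * b) n"
      unfolding eventually_prod_filter
      by (rule exI[of _ "\<lambda>f. \<forall>k\<le>n. fps_nth f k = fps_nth a k"],
          rule exI[of _ "\<lambda>f. \<forall>k\<le>n. fps_nth f k = fps_nth b k"])
         (simp add: eventually_fps_nth_eq_nhds_fps_strong fps_mult_nth)
  qed
qed

lemma fps_X_power_dvd_nth_eq_0:
  fixes f :: "'a::comm_ring_1 fps"
  assumes "fps_X ^ n dvd f" and "k < n"
  shows "fps_nth f k = 0"
  using assms by (auto simp: dvd_def fps_X_power_mult_nth)

lemma LIMSEQ_fpsI:
  fixes f :: "nat \<Rightarrow> 'a::comm_ring_1 fps"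
  assumes "\<And>n. fps_X ^ n dvd f n - L"
  shows "f \<longlonglongrightarrow> L"
proof (rule tendsto_fpsI)
  fix k
  show "\<forall>\<^sub>F n in sequentially. fps_nth (f n) k = fps_nth L k"
    using eventually_gt_at_top[of k]
    by eventually_elim (use fps_X_power_dvd_nth_eq_0[OF assms] in fastforce)
qed

text \<open>
  The topology is non-archimedean and complete, so terms of growing order are enough for convergence.
\<close>

lemma summable_fpsI:
  fixes f :: "nat \<Rightarrow> 'a::comm_ring_1 fps"
  assumes "\<And>n. fps_X ^ n dvd f n"
  shows "summable f"
proof -
  define s where "s = Abs_fps (\<lambda>k. \<Sum>j<Suc k. fps_nth (f j) k)"
  have "(\<lambda>n. \<Sum>j<n. f j) \<longlonglongrightarrow> s"
  proof (rule tendsto_fpsI)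
    fix k
    show "\<forall>\<^sub>F n in sequentially. fps_nth (\<Sum>j<n. f j) k = fps_nth s k"
      using eventually_gt_at_top[of k]
    proof eventually_elim
      case (elim n)
      have "(\<Sum>j<n. fps_nth (f j) k) = (\<Sum>j<Suc k. fps_nth (f j) k)"
        by (rule sum.mono_neutral_right)
           (use elim fps_X_power_dvd_nth_eq_0[OF assms] in auto)
      then show ?case by (simp add: s_def fps_sum_nth)
    qed
  qed
  then show ?thesis by (auto simp: summable_def sums_def)
qed

lemma fps_sums_mult:
  fixes f :: "nat \<Rightarrow> 'a::comm_ring_1 fps"
  assumes "f sums s"
  shows "(\<lambda>n. c * f n) sums (c * s)"
  using tendsto_mult[OF tendsto_const assms[unfolded sums_def], of c]
  by (simp add: sums_def sum_distrib_left)

section \<open>Reciprocals and \<open>q\<close>-factorials\<close>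

lemma fps_recip_nth_0 [simp]:
  "fps_nth (fps_recip f) 0 = 1" for f :: "'a::comm_ring_1 fps"
  by (simp add: fps_recip_def)

lemma fps_recip_mult_left:
  fixes f g :: "'a::comm_ring_1 fps"
  assumes "fps_nth f 0 = 1" and "fps_nth g 0 = 1"
  shows "f * fps_recip (f * g) = fps_recip g"
proof (rule fps_recip_unique[OF assms(2)])
  have "(f * g) * fps_recip (f * g) = 1"
    by (rule fps_recip_right) (simp add: assms)
  then show "g * (f * fps_recip (f * g)) = 1" by (simp add: mult_ac)
qed

lemma q_poch_0 [simp]: "q_poch A q 0 = 1"
  by (simp add: q_poch_def)

lemma q_poch_Suc: "q_poch A q (Suc n) = (1 - A * q ^ n) * q_poch A q n"
  by (simp add: q_poch_def mult.commute)

lemma q_poch_Suc_shift: "q_poch A q (Suc n) = (1 - A) * q_poch (A * q) q n"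
  unfolding q_poch_def by (subst prod.lessThan_Suc_shift) (simp add: mult.assoc)

abbreviation q_fact :: "nat \<Rightarrow> 'a::comm_ring_1 fps"
  where "q_fact \<equiv> q_poch fps_X fps_X"

lemma q_fact_Suc: "q_fact (Suc n) = (1 - fps_X ^ Suc n) * q_fact n"
  by (simp add: q_poch_Suc)

lemma q_poch_fps_X_nth_0:
  assumes "k > 0"
  shows "fps_nth (q_poch (fps_X ^ k) fps_X n :: 'a::comm_ring_1 fps) 0 = 1"
  by (induction n) (use assms in \<open>simp_all add: q_poch_Suc\<close>)

lemma q_fact_nth_0 [simp]: "fps_nth (q_fact n :: 'a::comm_ring_1 fps) 0 = 1"
  using q_poch_fps_X_nth_0[of 1 n] by simp

lemma q_fact_cong: "(fps_X ^ n :: 'a::comm_ring_1 fps) dvd q_fact (n + m) - q_fact n"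
proof (induction m)
  case (Suc m)
  have "(q_fact (n + Suc m) - q_fact n :: 'a fps)
      = (q_fact (n + m) - q_fact n) - fps_X ^ n * (fps_X ^ Suc m * q_fact (n + m))"
    by (simp add: q_poch_Suc algebra_simps power_add)
  then show ?case using Suc.IH by (metis dvd_diff dvd_triv_left)
qed simp

section \<open>The series over partitions into distinct parts\<close>

text \<open>The generating function of partitions into exactly \<open>j\<close> distinct parts.\<close>

definition distinct_term :: "nat \<Rightarrow> 'a::comm_ring_1 fps"
  where "distinct_term j = fps_X ^ (Suc j choose 2) * fps_recip (q_fact j)"

lemma distinct_term_0 [simp]: "distinct_term 0 = 1"
proof -
  have "fps_recip 1 = (1 :: 'a fps)"
    by (rule fps_recip_unique[symmetric]) simp_all
  then show ?thesis by (simp add: distinct_term_def numeral_2_eq_2)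
qed

lemma distinct_term_Suc:
  "(1 - fps_X ^ Suc j) * distinct_term (Suc j) = (fps_X ^ Suc j * distinct_term j :: 'a::comm_ring_1 fps)"
proof -
  have "(1 - fps_X ^ Suc j) * fps_recip (q_fact (Suc j)) = (fps_recip (q_fact j) :: 'a fps)"
    unfolding q_fact_Suc by (rule fps_recip_mult_left) simp_all
  moreover have "Suc (Suc j) choose 2 = Suc j + (Suc j choose 2)"
    by (simp add: numeral_2_eq_2)
  ultimately show ?thesis
    unfolding distinct_term_def by (simp only: power_add mult.assoc mult.left_commute[of "1 - fps_X ^ Suc j"])
qed

lemma fps_X_power_dvd_distinct_term: "(fps_X ^ j :: 'a::comm_ring_1 fps) dvd distinct_term j"
proof -
  have "j \<le> Suc j choose 2" by (simp add: numeral_2_eq_2)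
  then show ?thesis
    unfolding distinct_term_def by (intro dvd_mult2 le_imp_power_dvd)
qed

text \<open>Weighting by \<open>q^(k j)\<close> adds \<open>k\<close> to each of the \<open>j\<close> parts, so only parts above \<open>k\<close> remain.\<close>

definition distinct_series :: "nat \<Rightarrow> 'a::comm_ring_1 fps"
  where "distinct_series k = (\<Sum>j. (fps_X ^ k) ^ j * distinct_term j)"

lemma distinct_series_sums:
  "(\<lambda>j. (fps_X ^ k) ^ j * distinct_term j) sums (distinct_series k :: 'a::comm_ring_1 fps)"
  unfolding distinct_series_def
  by (intro summable_sums summable_fpsI dvd_mult fps_X_power_dvd_distinct_term)

text \<open>
  A partition into distinct parts above \<open>k\<close> either avoids the part \<open>k + 1\<close> or contains it once.
  Algebraically, \<open>1 = q^j + (1 - q^j)\<close> splits the \<open>j\<close>-th term, and \<open>1 - q^j\<close> cancels the last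
  factor of \<open>(q;q)_j\<close>.
\<close>

lemma distinct_series_step:
  "distinct_series k = (1 + fps_X ^ Suc k) * (distinct_series (Suc k) :: 'a::comm_ring_1 fps)"
proof -
  define f :: "nat \<Rightarrow> 'a fps" where "f j = (fps_X ^ Suc k) ^ j * distinct_term j" for j
  define g where "g j = (case j of 0 \<Rightarrow> 0 | Suc i \<Rightarrow> fps_X ^ Suc k * f i)" for j
  have f: "f sums distinct_series (Suc k)"
    unfolding f_def by (rule distinct_series_sums)
  have "(\<lambda>i. g (Suc i)) sums (fps_X ^ Suc k * distinct_series (Suc k))"
    using fps_sums_mult[OF f] by (simp add: g_def)
  then have g: "g sums (fps_X ^ Suc k * distinct_series (Suc k))"
    using sums_Suc[of g] by (simp add: g_def)
  have "(fps_X ^ k) ^ j * distinct_term j = f j + g j" for j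
  proof (cases j)
    case (Suc i)
    have "(fps_X ^ k) ^ j * distinct_term j - f j
        = (fps_X ^ k) ^ j * ((1 - fps_X ^ Suc i) * distinct_term (Suc i))"
      unfolding f_def Suc by (simp only: power_Suc2 power_mult_distrib) (simp add: algebra_simps)
    also have "\<dots> = g j"
      unfolding distinct_term_Suc Suc g_def f_def
      by (simp add: power_mult_distrib mult_ac)
    finally show ?thesis by (simp add: algebra_simps)
  qed (simp add: f_def g_def)
  then have "(\<lambda>j. (fps_X ^ k) ^ j * distinct_term j)
      sums (distinct_series (Suc k) + fps_X ^ Suc k * distinct_series (Suc k) :: 'a fps)"
    using sums_add[OF f g] by (simp only:)
  then have "distinct_series k
      = distinct_series (Suc k) + fps_X ^ Suc k * (distinct_series (Suc k) :: 'a fps)"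
    by (rule sums_unique2[OF distinct_series_sums])
  then show ?thesis by (simp only: distrib_right mult_1)
qed

definition distinct_prod :: "nat \<Rightarrow> 'a::comm_ring_1 fps"
  where "distinct_prod n = (\<Prod>i<n. 1 + fps_X ^ Suc i)"

lemma distinct_series_0_eq:
  "distinct_series 0 = distinct_prod n * (distinct_series n :: 'a::comm_ring_1 fps)"
proof (induction n)
  case (Suc n)
  have "distinct_prod (Suc n) = distinct_prod n * (1 + fps_X ^ Suc n :: 'a fps)"
    by (simp only: distinct_prod_def prod.lessThan_Suc)
  then show ?case
    using Suc.IH distinct_series_step[of n, where 'a = 'a] by (simp only: mult.assoc)
qed (simp add: distinct_prod_def)

lemma distinct_series_cong_1: "(fps_X ^ n :: 'a::comm_ring_1 fps) dvd distinct_series n - 1"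
proof -
  let ?g = "\<lambda>j. (fps_X ^ n) ^ j * distinct_term (Suc j) :: 'a fps"
  have "fps_X ^ j dvd ?g j" for j
    using fps_X_power_dvd_distinct_term[of "Suc j"]
    by (intro dvd_mult) (erule power_le_dvd, simp)
  then have "?g sums suminf ?g" by (intro summable_sums summable_fpsI)
  from fps_sums_mult[OF this, of "fps_X ^ n"]
  have "(\<lambda>j. (fps_X ^ n) ^ Suc j * distinct_term (Suc j)) sums (fps_X ^ n * suminf ?g)"
    by (simp add: mult_ac)
  from sums_unique2[OF distinct_series_sums sums_Suc[OF this]]
  show ?thesis by simp
qed

lemma distinct_prod_cong: "(fps_X ^ n :: 'a::comm_ring_1 fps) dvd distinct_prod n - distinct_series 0"
proof -
  have "distinct_prod n - distinct_series 0 = - (distinct_prod n * (distinct_series n - 1 :: 'a fps))"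
    by (subst distinct_series_0_eq[of n]) (simp add: algebra_simps)
  then show ?thesis using distinct_series_cong_1[of n, where 'a = 'a] by simp
qed

section \<open>Euler's identity\<close>

definition odd_prod :: "nat \<Rightarrow> 'a::comm_ring_1 fps"
  where "odd_prod n = (\<Prod>i<n. fps_recip (1 - fps_X ^ (2 * i + 1)))"

lemma odd_prod_inverse: "odd_prod n * (\<Prod>i<n. 1 - fps_X ^ (2 * i + 1)) = (1 :: 'a::comm_ring_1 fps)"
proof -
  have "fps_recip (1 - fps_X ^ (2 * i + 1)) * (1 - fps_X ^ (2 * i + 1)) = (1 :: 'a fps)" for i
    using fps_recip_right[of "1 - fps_X ^ (2 * i + 1) :: 'a fps"] by (simp add: mult.commute)
  then show ?thesis unfolding odd_prod_def by (subst prod.distrib[symmetric]) simp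
qed

text \<open>
  The factors \<open>(1 + q^i)(1 - q^i) = 1 - q^(2i)\<close> supply the even-indexed factors of \<open>(q;q)_(2n)\<close>.
\<close>

lemma odd_times_distinct:
  "(\<Prod>i<n. 1 - fps_X ^ (2 * i + 1)) * distinct_prod n * q_fact n
    = (q_fact (2 * n) :: 'a::comm_ring_1 fps)"
proof (induction n)
  case (Suc n)
  let ?x = "fps_X ^ Suc n :: 'a fps"
  have sq: "(1 + ?x) * (1 - ?x) = 1 - fps_X ^ Suc (Suc (2 * n))"
    by (simp add: algebra_simps flip: power_add mult_2)
  have even: "q_fact (2 * Suc n)
      = (1 - fps_X ^ Suc (Suc (2 * n))) * ((1 - fps_X ^ Suc (2 * n)) * q_fact (2 * n) :: 'a fps)"
    using q_fact_Suc[of "2 * n", where 'a = 'a] q_fact_Suc[of "Suc (2 * n)", where 'a = 'a] by simp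
  have "(\<Prod>i<Suc n. 1 - fps_X ^ (2 * i + 1)) * distinct_prod (Suc n) * q_fact (Suc n)
      = ((\<Prod>i<n. 1 - fps_X ^ (2 * i + 1)) * distinct_prod n * q_fact n)
        * (1 - fps_X ^ Suc (2 * n)) * ((1 + ?x) * (1 - ?x))"
    unfolding q_fact_Suc by (simp add: distinct_prod_def mult_ac del: power_Suc)
  also have "\<dots> = q_fact (2 * Suc n)"
    unfolding Suc.IH sq even by (simp only: mult_ac)
  finally show ?case .
qed (simp add: distinct_prod_def)

lemma odd_prod_cong: "(fps_X ^ n :: 'a::comm_ring_1 fps) dvd distinct_prod n - odd_prod n"
proof -
  let ?O = "\<Prod>i<n. 1 - fps_X ^ (2 * i + 1) :: 'a fps"
  let ?r = "fps_recip (q_fact n) :: 'a fps"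
  have r: "q_fact n * ?r = 1" by (rule fps_recip_right) simp
  have "odd_prod n * ?r * (q_fact (n + n) - q_fact n)
      = odd_prod n * ?r * (?O * distinct_prod n * q_fact n - q_fact n)"
    using odd_times_distinct[of n, where 'a = 'a] by (simp add: mult_2)
  also have "\<dots> = (odd_prod n * ?O) * (q_fact n * ?r) * distinct_prod n - odd_prod n * (q_fact n * ?r)"
    by (simp add: algebra_simps)
  also have "\<dots> = distinct_prod n - odd_prod n"
    unfolding odd_prod_inverse r by simp
  finally have "distinct_prod n - odd_prod n = odd_prod n * ?r * (q_fact (n + n) - q_fact n)" ..
  then show ?thesis using q_fact_cong[of n n, where 'a = 'a] by simp
qed

theorem odd_prod_LIMSEQ: "odd_prod \<longlonglongrightarrow> (distinct_series 0 :: 'a::comm_ring_1 fps)"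
proof (rule LIMSEQ_fpsI)
  fix n
  have "odd_prod n - distinct_series 0
      = (distinct_prod n - distinct_series 0) - (distinct_prod n - odd_prod n :: 'a fps)"
    by simp
  then show "(fps_X ^ n :: 'a fps) dvd odd_prod n - distinct_series 0"
    using distinct_prod_cong odd_prod_cong by (metis dvd_diff)
qed

section \<open>Removing the factor at \<open>M\<close>\<close>

lemma prod_odd_atMost:
  "(\<Prod>i\<le>m. if odd i then fps_recip (1 - fps_X ^ i) else 1)
    = (odd_prod (Suc m div 2) :: 'a::comm_ring_1 fps)"
proof (induction m)
  case (Suc m)
  show ?case
  proof (cases "odd (Suc m)")
    case True
    then obtain n where "m = 2 * n" by (metis even_Suc evenE)
    then show ?thesis using Suc.IH by (simp add: odd_prod_def del: power_Suc)
  next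
    case False
    then obtain n where "m = 2 * n + 1" by (metis even_Suc oddE)
    then show ?thesis using Suc.IH by simp
  qed
qed (simp add: odd_prod_def)

lemma prod_odd_factor:
  assumes "odd M" and "M \<le> m"
  shows "(\<Prod>i\<le>m. odd_factor M i :: 'a::comm_ring_1 poly fps)
    = (1 - fps_X ^ M) * odd_prod (Suc m div 2)"
proof -
  let ?h = "\<lambda>i. if odd i then fps_recip (1 - fps_X ^ i) else 1 :: 'a poly fps"
  have "(\<Prod>i\<le>m. odd_factor M i) = (\<Prod>i\<in>{..m} - {M}. odd_factor M i :: 'a poly fps)"
    using assms by (subst prod.remove[of _ M]) (simp_all add: odd_factor_def)
  also have "\<dots> = (\<Prod>i\<in>{..m} - {M}. ?h i)"
    by (rule prod.cong) (auto simp: odd_factor_def)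
  finally have *: "(\<Prod>i\<le>m. odd_factor M i) = (\<Prod>i\<in>{..m} - {M}. ?h i)" .
  have "odd_prod (Suc m div 2) = fps_recip (1 - fps_X ^ M) * (\<Prod>i\<in>{..m} - {M}. ?h i)"
    unfolding prod_odd_atMost[symmetric]
    using assms by (subst prod.remove[of _ M]) simp_all
  moreover have "(1 - fps_X ^ M) * fps_recip (1 - fps_X ^ M) = (1 :: 'a poly fps)"
    using \<open>odd M\<close> by (intro fps_recip_right) (auto simp: odd_pos)
  ultimately show ?thesis unfolding * by (simp flip: mult.assoc)
qed

lemma odd_factor_has_prod:
  assumes "odd M"
  shows "(odd_factor M :: nat \<Rightarrow> 'a::comm_ring_1 poly fps)
    has_prod ((1 - fps_X ^ M) * distinct_series 0)"
proof -
  let ?E = "distinct_series 0 :: 'a poly fps"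
  have "filterlim (\<lambda>m. Suc m div 2) at_top sequentially"
    unfolding filterlim_at_top eventually_sequentially
    by (intro allI, rule_tac x = "2 * Z" in exI) auto
  then have "(\<lambda>m. (1 - fps_X ^ M) * odd_prod (Suc m div 2)) \<longlonglongrightarrow> (1 - fps_X ^ M) * ?E"
    by (intro tendsto_mult tendsto_const filterlim_compose[OF odd_prod_LIMSEQ])
  moreover have "\<forall>\<^sub>F m in sequentially. (1 - fps_X ^ M) * odd_prod (Suc m div 2)
      = (\<Prod>i\<le>m. odd_factor M i :: 'a poly fps)"
    using eventually_ge_at_top[of M]
    by eventually_elim (simp add: prod_odd_factor[OF assms])
  ultimately have lim: "(\<lambda>m. \<Prod>i\<le>m. odd_factor M i) \<longlonglongrightarrow> (1 - fps_X ^ M) * ?E"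
    by (rule Lim_transform_eventually)
  have "fps_nth ?E 0 = 1"
    using fps_X_power_dvd_nth_eq_0[OF distinct_series_cong_1[of 1, where 'a = "'a poly"], of 0]
      distinct_series_step[of 0, where 'a = "'a poly"] by simp
  then have "fps_nth ((1 - fps_X ^ M) * ?E) 0 = 1"
    using odd_pos[OF assms] by simp
  then have "(1 - fps_X ^ M) * ?E \<noteq> 0" by (metis fps_zero_nth zero_neq_one)
  then show ?thesis using lim by (simp add: has_prod_def raw_has_prod_def)
qed

text \<open>
  Every factor has constant coefficient \<open>1\<close>, so none is \<open>0\<close>.  The product therefore cannot take
  the value \<open>0\<close> that \<^const>\<open>has_prod\<close> assigns when a factor vanishes, and its value is the limit
  of the partial products.
\<close>

lemma prodinf_odd_factor:
  assumes "odd M"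
  shows "(\<Prod>i. odd_factor M i :: 'a::comm_ring_1 poly fps)
    = (1 - fps_X ^ M) * distinct_series 0" (is "_ = ?p")
proof -
  note p = odd_factor_has_prod[OF assms, where 'a = 'a]
  have "fps_nth (odd_factor M i :: 'a poly fps) 0 = 1" for i
    by (simp add: odd_factor_def)
  then have nz: "odd_factor M i \<noteq> (0 :: 'a poly fps)" for i
    by (metis fps_zero_nth zero_neq_one)
  show ?thesis
    unfolding prodinf_def
  proof (rule the_equality[where P = "\<lambda>p. odd_factor M has_prod p", OF p])
    fix r :: "'a poly fps"
    assume "odd_factor M has_prod r"
    then show "r = ?p"
      using p nz unfolding has_prod_def raw_has_prod_def by (auto intro: LIMSEQ_unique)
  qed
qed

section \<open>The sum over \<open>j \<ge> 2\<close>\<close>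

text \<open>The factor \<open>1 - q\<close> cancels the first factor of \<open>(q;q)_j\<close>.\<close>

lemma sum_term_eq:
  "(sum_term M (j + 2) :: 'a::comm_ring_1 poly fps)
    = q_bracket q_var M * fps_recip (1 - w_var * q_var ^ M) * (1 - fps_X) * distinct_term (j + 2)"
proof -
  have "q_fact (j + 2) = (1 - fps_X) * (q_poch (fps_X ^ 2) fps_X (j + 1) :: 'a poly fps)"
    using q_poch_Suc_shift[of "fps_X :: 'a poly fps" fps_X "j + 1"]
    by (simp add: power2_eq_square)
  moreover have "(1 - fps_X) * fps_recip ((1 - fps_X) * q_poch (fps_X ^ 2) fps_X (j + 1))
      = (fps_recip (q_poch (fps_X ^ 2) fps_X (j + 1)) :: 'a poly fps)"
    by (rule fps_recip_mult_left) (simp_all add: q_poch_fps_X_nth_0)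
  ultimately have "fps_recip (q_poch (fps_X ^ 2) fps_X (j + 2 - 1))
      = (1 - fps_X) * (fps_recip (q_fact (j + 2)) :: 'a poly fps)"
    by simp
  then show ?thesis
    unfolding sum_term_def distinct_term_def Suc_eq_plus1 by (simp only: mult_ac)
qed

lemma distinct_term_sums_tail:
  "(\<lambda>j. (1 - fps_X) * distinct_term (j + 2))
    sums ((1 - fps_X) * distinct_series 0 - 1 :: 'a::comm_ring_1 fps)"
proof -
  let ?t = "\<lambda>j. (1 - fps_X) * distinct_term j :: 'a fps"
  have "?t sums ((1 - fps_X) * distinct_series 0)"
    using fps_sums_mult[OF distinct_series_sums[of 0]] by simp
  then have "(\<lambda>n. \<Sum>j<n + 2. ?t j) \<longlonglongrightarrow> (1 - fps_X) * distinct_series 0"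
    unfolding sums_def by (rule LIMSEQ_ignore_initial_segment)
  from tendsto_add[OF this tendsto_const[of "-1"]]
  have lim: "(\<lambda>n. (\<Sum>j<n + 2. ?t j) - 1) \<longlonglongrightarrow> (1 - fps_X) * distinct_series 0 - 1"
    by simp
  have "?t 1 = fps_X"
    using distinct_term_Suc[of 0, where 'a = 'a] by simp
  then have "(\<Sum>j<n + 2. ?t j) - 1 = (\<Sum>j<n. ?t (j + 2))" for n
    by (simp add: sum.lessThan_Suc_shift del: sum.lessThan_Suc)
  with lim show ?thesis unfolding sums_def by simp
qed

theorem corollary3p2:
  fixes M :: nat
  assumes "odd M"
  shows "convergent_prod (odd_factor M :: nat \<Rightarrow> 'a::comm_ring_1 poly fps)
    \<and> summable (\<lambda>j. sum_term M (j + 2) :: 'a poly fps)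
    \<and> fps_recip (1 - w_var * q_var ^ M) * (\<Prod>i. odd_factor M i)
        = (1 :: 'a poly fps)
          + ((\<Sum>i = 1..<M. q_var ^ i) + w_var * q_var ^ M) * fps_recip (1 - w_var * q_var ^ M)
          + (\<Sum>j. sum_term M (j + 2))"
proof -
  define D where "D = fps_recip (1 - w_var * q_var ^ M :: 'a poly fps)"
  define B where "B = (q_bracket q_var M :: 'a poly fps)"
  let ?E = "distinct_series 0 :: 'a poly fps"
  have M: "M > 0" using assms by (rule odd_pos)
  note hp = odd_factor_has_prod[OF assms, where 'a = 'a]
  have sums: "(\<lambda>j. sum_term M (j + 2)) sums (B * D * ((1 - fps_X) * ?E - 1))"
    using fps_sums_mult[OF distinct_term_sums_tail, of "B * D"]
    unfolding sum_term_eq B_def D_def by (simp only: mult.assoc)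
  have D: "(1 - w_var * q_var ^ M) * D = 1"
    unfolding D_def using M by (intro fps_recip_right) simp
  have B: "B = 1 + (\<Sum>i = 1..<M. q_var ^ i)"
    using M by (simp add: B_def q_bracket_def lessThan_atLeast0 sum.atLeast_Suc_lessThan)
  have "1 + ((\<Sum>i = 1..<M. q_var ^ i) + w_var * q_var ^ M) * D
      = (1 - w_var * q_var ^ M) * D + (B - 1 + w_var * q_var ^ M) * D"
    unfolding D B by simp
  also have "\<dots> = B * D" by (simp add: algebra_simps)
  finally have "1 + ((\<Sum>i = 1..<M. q_var ^ i) + w_var * q_var ^ M) * D
      + B * D * ((1 - fps_X) * ?E - 1) = D * ((1 - fps_X) * B * ?E)"
    by (simp add: algebra_simps)
  also have "\<dots> = D * ((1 - fps_X ^ M) * ?E)"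
    unfolding B_def q_bracket_quotient ..
  finally show ?thesis
    using hp sums prodinf_odd_factor[OF assms, where 'a = 'a] sums_unique[OF sums]
    by (auto simp: D_def summable_def has_prod_def convergent_prod_def)
qed

end
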